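(* Let $(\mathfrak g,[\ ,\ ])$ be a Leibniz algebra over $k$ with a representation $(V,\rho^L,\rho^R)$, and let $(N,S)$, with $N\in\mathfrak{gl}(\mathfrak g)$ and $S\in\mathfrak{gl}(V)$, be a Nijenhuis pair on $(\mathfrak g,[\ ,\ ])$ with the representation $(V,\rho^L,\rho^R)$. Define, for $y,y_1,y_2\in\mathfrak g$, $$\omega(y_1,y_2)=[N(y_1),y_2]+[y_1,N(y_2)]-N[y_1,y_2],$$ $$\varpi^L(y)=\rho^L(N(y))+\rho^L(y)S-S\rho^L(y),\qquad \varpi^R(y)=\rho^R(N(y))+\rho^R(y)S-S\rho^R(y).$$ Then $(\omega,\varpi^L,\varpi^R)$ generates a trivial infinitesimal deformation of $(\mathfrak g,[\ ,\ ])$ with the representation $(V,\rho^L,\rho^R)$.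
   Context: $k$ is a field of characteristic $0$; all vector spaces are finite dimensional over $k$. A (left) Leibniz algebra $(\mathfrak g,[\ ,\ ])$ is a vector space with a bilinear bracket satisfying $[x,[y,z]]=[[x,y],z]+[y,[x,z]]$. A representation $(V,\rho^L,\rho^R)$ of it is a vector space $V$ with linear maps $\rho^L,\rho^R:\mathfrak g\to\mathfrak{gl}(V)$ such that for all $x,y\in\mathfrak g$: $\rho^L([x,y])=[\rho^L(x),\rho^L(y)]$, $\rho^R([x,y])=[\rho^L(x),\rho^R(y)]$ (commutators in $\mathfrak{gl}(V)$), and $\rho^R(y)\rho^L(x)=-\rho^R(y)\rho^R(x)$. A Nijenhuis operator on $(\mathfrak g,[\ ,\ ])$ is a linear map $N:\mathfrak g\to\mathfrak g$ with $[N(x),N(y)]=N([N(x),y]+[x,N(y)]-N[x,y])$ for all $x,y$. A pair $(N,S)$, $N\in\mathfrak{gl}(\mathfrak g)$, $S\in\mathfrak{gl}(V)$, is a Nijenhuis pair if $N$ is a Nijenhuis operator and for all $y\in\mathfrak g$, $w\in V$ and for each $\rho\in\{\rho^L,\rho^R\}$: $\rho(N(y))S(w)=S(\rho(N(y))w)+S(\rho(y)S(w))-S^2(\rho(y)w)$. Given a bilinear map $\omega:\mathfrak g\times\mathfrak g\to\mathfrak g$ and linear maps $\varpi^L,\varpi^R:\mathfrak g\to\mathfrak{gl}(V)$, put for $t\in k$: $[x,y]_t=[x,y]+t\,\omega(x,y)$, $\rho^L_t(x)=\rho^L(x)+t\varpi^L(x)$, $\rho^R_t(x)=\rho^R(x)+t\varpi^R(x)$.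 The triple $(\omega,\varpi^L,\varpi^R)$ generates an infinitesimal deformation if for each $t$, $(\mathfrak g,[\ ,\ ]_t)$ is a Leibniz algebra and $(V,\rho^L_t,\rho^R_t)$ is a representation of it. This infinitesimal deformation is trivial if it is equivalent to the undeformed one, that is, if there are $N'\in\mathfrak{gl}(\mathfrak g)$ and $S'\in\mathfrak{gl}(V)$ such that for all $t$ and all $x,y\in\mathfrak g$: $(I_{\mathfrak g}+tN')([x,y]_t)=[(I_{\mathfrak g}+tN')(x),(I_{\mathfrak g}+tN')(y)]$, $(I_V+tS')\rho^L_t(x)=\rho^L((I_{\mathfrak g}+tN')(x))(I_V+tS')$, $(I_V+tS')\rho^R_t(x)=\rho^R((I_{\mathfrak g}+tN')(x))(I_V+tS')$. *)

theory Defs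
  imports Complex_Main
begin

text \<open>
  Vector spaces live on whole types and are given by their scalar multiplication.
  An element of \<open>gl(V)\<close> is a function satisfying \<^const>\<open>Vector_Spaces.linear\<close>, and a
  linear map \<open>g \<rightarrow> gl(V)\<close> is a curried bilinear map \<open>g \<times> V \<rightarrow> V\<close>.
\<close>

definition bilinear_map ::
  "('k::field \<Rightarrow> 'a::ab_group_add \<Rightarrow> 'a) \<Rightarrow> ('k \<Rightarrow> 'b::ab_group_add \<Rightarrow> 'b) \<Rightarrow>
   ('k \<Rightarrow> 'c::ab_group_add \<Rightarrow> 'c) \<Rightarrow> ('a \<Rightarrow> 'b \<Rightarrow> 'c) \<Rightarrow> bool" where
  "bilinear_map sa sb sc f \<longleftrightarrow>
     (\<forall>x. Vector_Spaces.linear sb sc (f x)) \<and> (\<forall>y. Vector_Spaces.linear sa sc (\<lambda>x. f x y))"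

definition commutator :: "('a::ab_group_add \<Rightarrow> 'a) \<Rightarrow> ('a \<Rightarrow> 'a) \<Rightarrow> 'a \<Rightarrow> 'a" where
  "commutator f g = (\<lambda>v. f (g v) - g (f v))"

locale leibniz_algebra = vector_space sg
  for sg :: "'k::field_char_0 \<Rightarrow> 'g::ab_group_add \<Rightarrow> 'g" +
  fixes br :: "'g \<Rightarrow> 'g \<Rightarrow> 'g"
  assumes bilinear_br: "bilinear_map sg sg sg br"
    and leibniz: "br x (br y z) = br (br x y) z + br y (br x z)"

locale leibniz_representation = leibniz_algebra sg br + V: vector_space sv
  for sg :: "'k::field_char_0 \<Rightarrow> 'g::ab_group_add \<Rightarrow> 'g"
    and br :: "'g \<Rightarrow> 'g \<Rightarrow> 'g"
    and sv :: "'k \<Rightarrow> 'v::ab_group_add \<Rightarrow> 'v" +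
  fixes rhoL rhoR :: "'g \<Rightarrow> 'v \<Rightarrow> 'v"
  assumes bilinear_rhoL: "bilinear_map sg sv sv rhoL"
    and bilinear_rhoR: "bilinear_map sg sv sv rhoR"
    and rhoL_br: "rhoL (br x y) = commutator (rhoL x) (rhoL y)"
    and rhoR_br: "rhoR (br x y) = commutator (rhoL x) (rhoR y)"
    and rhoR_rhoL: "rhoR y (rhoL x v) = - rhoR y (rhoR x v)"

definition nijenhuis_operator ::
  "('k::field \<Rightarrow> 'g::ab_group_add \<Rightarrow> 'g) \<Rightarrow> ('g \<Rightarrow> 'g \<Rightarrow> 'g) \<Rightarrow> ('g \<Rightarrow> 'g) \<Rightarrow> bool" where
  "nijenhuis_operator sg br N \<longleftrightarrow>
     Vector_Spaces.linear sg sg N \<and>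
     (\<forall>x y. br (N x) (N y) = N (br (N x) y + br x (N y) - N (br x y)))"

definition nijenhuis_pair ::
  "('k::field \<Rightarrow> 'g::ab_group_add \<Rightarrow> 'g) \<Rightarrow> ('g \<Rightarrow> 'g \<Rightarrow> 'g) \<Rightarrow>
   ('k \<Rightarrow> 'v::ab_group_add \<Rightarrow> 'v) \<Rightarrow> ('g \<Rightarrow> 'v \<Rightarrow> 'v) \<Rightarrow> ('g \<Rightarrow> 'v \<Rightarrow> 'v) \<Rightarrow>
   ('g \<Rightarrow> 'g) \<Rightarrow> ('v \<Rightarrow> 'v) \<Rightarrow> bool" where
  "nijenhuis_pair sg br sv rhoL rhoR N S \<longleftrightarrow>
     nijenhuis_operator sg br N \<and> Vector_Spaces.linear sv sv S \<and>
     (\<forall>rho \<in> {rhoL, rhoR}. \<forall>y w.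
        rho (N y) (S w) = S (rho (N y) w) + S (rho y (S w)) - S (S (rho y w)))"

definition deform :: "('k \<Rightarrow> 'c \<Rightarrow> 'c) \<Rightarrow> ('a \<Rightarrow> 'b \<Rightarrow> 'c) \<Rightarrow> ('a \<Rightarrow> 'b \<Rightarrow> 'c) \<Rightarrow>
    'k \<Rightarrow> 'a \<Rightarrow> 'b \<Rightarrow> 'c::ab_group_add" where
  "deform s f f1 t = (\<lambda>x y. f x y + s t (f1 x y))"

definition generates_infinitesimal_deformation ::
  "('k::field_char_0 \<Rightarrow> 'g::ab_group_add \<Rightarrow> 'g) \<Rightarrow> ('g \<Rightarrow> 'g \<Rightarrow> 'g) \<Rightarrow>
   ('k \<Rightarrow> 'v::ab_group_add \<Rightarrow> 'v) \<Rightarrow> ('g \<Rightarrow> 'v \<Rightarrow> 'v) \<Rightarrow> ('g \<Rightarrow> 'v \<Rightarrow> 'v) \<Rightarrow>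
   ('g \<Rightarrow> 'g \<Rightarrow> 'g) \<Rightarrow> ('g \<Rightarrow> 'v \<Rightarrow> 'v) \<Rightarrow> ('g \<Rightarrow> 'v \<Rightarrow> 'v) \<Rightarrow> bool" where
  "generates_infinitesimal_deformation sg br sv rhoL rhoR omega varpiL varpiR \<longleftrightarrow>
     bilinear_map sg sg sg omega \<and> bilinear_map sg sv sv varpiL \<and> bilinear_map sg sv sv varpiR \<and>
     (\<forall>t. leibniz_algebra sg (deform sg br omega t) \<and>
          leibniz_representation sg (deform sg br omega t) sv
            (deform sv rhoL varpiL t) (deform sv rhoR varpiR t))"

definition equivalent_to_undeformed ::
  "('k::field_char_0 \<Rightarrow> 'g::ab_group_add \<Rightarrow> 'g) \<Rightarrow> ('g \<Rightarrow> 'g \<Rightarrow> 'g) \<Rightarrow>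
   ('k \<Rightarrow> 'v::ab_group_add \<Rightarrow> 'v) \<Rightarrow> ('g \<Rightarrow> 'v \<Rightarrow> 'v) \<Rightarrow> ('g \<Rightarrow> 'v \<Rightarrow> 'v) \<Rightarrow>
   ('g \<Rightarrow> 'g \<Rightarrow> 'g) \<Rightarrow> ('g \<Rightarrow> 'v \<Rightarrow> 'v) \<Rightarrow> ('g \<Rightarrow> 'v \<Rightarrow> 'v) \<Rightarrow> bool" where
  "equivalent_to_undeformed sg br sv rhoL rhoR omega varpiL varpiR \<longleftrightarrow>
     (\<exists>N' S'. Vector_Spaces.linear sg sg N' \<and> Vector_Spaces.linear sv sv S' \<and>
        (\<forall>t. let P = (\<lambda>x. x + sg t (N' x)); Q = (\<lambda>v. v + sv t (S' v)) in
           (\<forall>x y. P (deform sg br omega t x y) = br (P x) (P y)) \<and>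
           (\<forall>x v. Q (deform sv rhoL varpiL t x v) = rhoL (P x) (Q v)) \<and>
           (\<forall>x v. Q (deform sv rhoR varpiR t x v) = rhoR (P x) (Q v))))"

definition generates_trivial_infinitesimal_deformation ::
  "('k::field_char_0 \<Rightarrow> 'g::ab_group_add \<Rightarrow> 'g) \<Rightarrow> ('g \<Rightarrow> 'g \<Rightarrow> 'g) \<Rightarrow>
   ('k \<Rightarrow> 'v::ab_group_add \<Rightarrow> 'v) \<Rightarrow> ('g \<Rightarrow> 'v \<Rightarrow> 'v) \<Rightarrow> ('g \<Rightarrow> 'v \<Rightarrow> 'v) \<Rightarrow>
   ('g \<Rightarrow> 'g \<Rightarrow> 'g) \<Rightarrow> ('g \<Rightarrow> 'v \<Rightarrow> 'v) \<Rightarrow> ('g \<Rightarrow> 'v \<Rightarrow> 'v) \<Rightarrow> bool" where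
  "generates_trivial_infinitesimal_deformation sg br sv rhoL rhoR omega varpiL varpiR \<longleftrightarrow>
     generates_infinitesimal_deformation sg br sv rhoL rhoR omega varpiL varpiR \<and>
     equivalent_to_undeformed sg br sv rhoL rhoR omega varpiL varpiR"

end

theory Submission
  imports Defs "HOL-Analysis.Product_Vector"
begin

text \<open>
  A Nijenhuis operator \<open>N\<close> contracts a Leibniz bracket to \<open>[x,y]\<^sub>N = [Nx,y] + [x,Ny] - N[x,y]\<close>, which
  is again a Leibniz bracket (\<open>leibniz_algebra_contraction\<close>), and the Nijenhuis identity says exactly
  that \<open>N\<close> carries the new bracket to the old one (\<open>nijenhuis_operator_contraction\<close>).  Two observations reduce the theorem to these facts.

  The first one removes the parameter. For every \<open>t\<close> the operator \<open>I + tN\<close> is again Nijenhuis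
  (\<open>nijenhuis_operator_pencil\<close>), and contracting by it gives \<open>[x,y] + t[x,y]\<^sub>N\<close>, because contraction is
  linear in the operator and contraction by \<open>I\<close> does nothing (\<open>contraction_pencil\<close>). So the deformed
  bracket is itself a contraction, hence Leibniz for each \<open>t\<close>, and the Nijenhuis identity of \<open>I + tN\<close> is
  the required equivalence with the undeformed bracket.

  The second one removes the representation.  The axioms of a representation say precisely that the
  semidirect product on \<open>g \<times> V\<close>, with \<open>[x + u, y + v] = [x,y] + \<rho>\<^sup>L(x)v + \<rho>\<^sup>R(y)u\<close>, is a Leibniz algebra
  (\<open>leibniz_algebra_semidirect\<close>, \<open>leibniz_representation_of_semidirect\<close>), and a Nijenhuis pair
  \<open>(N,S)\<close> is a Nijenhuis operator \<open>N \<times> S\<close> on it.  Contracting the semidirect product by \<open>N \<times> S\<close> produces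
  \<open>\<omega>\<close>, \<open>\<varpi>\<^sup>L\<close> and \<open>\<varpi>\<^sup>R\<close> as its three components, so the argument above, applied to
  \<open>g \<times> V\<close> and \<open>I + t(N \<times> S)\<close>, gives all claims at once after taking components.
\<close>

section \<open>Bilinear maps\<close>

lemma bilinear_map_simps:
  assumes "bilinear_map sa sb sc f"
  shows "f (x + y) v = f x v + f y v" and "f x (u + v) = f x u + f x v"
    and "f (sa c x) v = sc c (f x v)" and "f x (sb c v) = sc c (f x v)"
    and "f (x - y) v = f x v - f y v" and "f x (u - v) = f x u - f x v"
    and "f 0 v = 0" and "f x 0 = 0"
proof -
  have left: "Vector_Spaces.linear sa sc (\<lambda>x. f x v)" and right: "Vector_Spaces.linear sb sc (f x)" for x v
    using assms by (simp_all add: bilinear_map_def)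
  interpret left: Vector_Spaces.linear sa sc "\<lambda>x. f x v" by (fact left)
  interpret right: Vector_Spaces.linear sb sc "f x" by (fact right)
  show "f (x + y) v = f x v + f y v" and "f x (u + v) = f x u + f x v"
    and "f (sa c x) v = sc c (f x v)" and "f x (sb c v) = sc c (f x v)"
    and "f (x - y) v = f x v - f y v" and "f x (u - v) = f x u - f x v"
    and "f 0 v = 0" and "f x 0 = 0"
    by (fact left.add right.add left.scale right.scale left.diff right.diff left.zero right.zero)+
qed

lemma bilinear_map_deform:
  assumes f: "bilinear_map sa sb sc f" and g: "bilinear_map sa sb sc g"
  shows "bilinear_map sa sb sc (deform sc f g t)"
proof -
  interpret C: vector_space sc using f by (simp add: bilinear_map_def Vector_Spaces.linear_iff)
  show ?thesis
    using f g by (simp add: bilinear_map_def Vector_Spaces.linear_iff deform_def C.scale_right_distrib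
        C.scale_left_commute[of t] algebra_simps)
qed

text \<open>
  This shape covers \<open>\<omega>\<close> (the bracket as the left action of the algebra on itself) as well as
  \<open>\<varpi>\<^sup>L\<close> and \<open>\<varpi>\<^sup>R\<close>.
\<close>

lemma bilinear_map_coboundary:
  assumes f: "bilinear_map sa sb sb f"
    and N: "Vector_Spaces.linear sa sa N" and S: "Vector_Spaces.linear sb sb S"
  shows "bilinear_map sa sb sb (\<lambda>x v. f (N x) v + f x (S v) - S (f x v))"
proof -
  interpret B: vector_space sb using f by (simp add: bilinear_map_def Vector_Spaces.linear_iff)
  show ?thesis
    using assms by (simp add: bilinear_map_def Vector_Spaces.linear_iff B.scale_right_distrib
        B.scale_right_diff_distrib algebra_simps)
qed

section \<open>Contraction of a Leibniz bracket by a Nijenhuis operator\<close>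

definition contraction :: "('g \<Rightarrow> 'g \<Rightarrow> 'g) \<Rightarrow> ('g \<Rightarrow> 'g) \<Rightarrow> 'g \<Rightarrow> 'g \<Rightarrow> 'g::ab_group_add" where
  "contraction br N x y = br (N x) y + br x (N y) - N (br x y)"

lemma nijenhuis_operator_contraction:
  "nijenhuis_operator sg br N \<Longrightarrow> N (contraction br N x y) = br (N x) (N y)"
  unfolding nijenhuis_operator_def contraction_def by metis

text \<open>
  The expansion of \<open>[x,[y,z]\<^sub>N]\<^sub>N\<close> contains two terms where \<open>N\<close> acts on the inner bracket \<open>[y,z]\<close>, namely
  \<open>-[Nx, N[y,z]]\<close> and \<open>N[x, N[y,z]]\<close>.  Rewriting the first by the Nijenhuis identity for \<open>x\<close> and \<open>[y,z]\<close>
  cancels the second and leaves \<open>-N[Nx, [y,z]] + NN[x, [y,z]]\<close>, which completes the other terms to an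
  expression that treats \<open>x\<close>, \<open>y\<close>, \<open>z\<close> alike.  The outcome is \<open>C\<close> applied to the trilinear map \<open>[x,[y,z]]\<close>, and likewise for
  \<open>[[x,y]\<^sub>N,z]\<^sub>N\<close> and \<open>[[x,y],z]\<close>.  As \<open>C\<close> is additive and commutes with permuting the three arguments, it
  transports the Leibniz identity from the original bracket to the contracted one.
\<close>

lemma leibniz_algebra_contraction:
  assumes L: "leibniz_algebra sg br" and N: "nijenhuis_operator sg br N"
  shows "leibniz_algebra sg (contraction br N)"
proof -
  interpret leibniz_algebra sg br by (fact L)
  note br_lin = bilinear_map_simps[OF bilinear_br]
  interpret N: Vector_Spaces.linear sg sg N using N by (simp add: nijenhuis_operator_def)
  note N_lin = N.add N.scale N.diff
  note N_contraction = nijenhuis_operator_contraction[OF N]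
  have NN: "br (N x) (N y) = N (br (N x) y) + N (br x (N y)) - N (N (br x y))" for x y
    using N by (simp add: nijenhuis_operator_def N_lin)
  define C where "C T x y z = T (N x) (N y) z + T (N x) y (N z) + T x (N y) (N z)
      - N (T (N x) y z + T x (N y) z + T x y (N z)) + N (N (T x y z))"
    for T :: "'b \<Rightarrow> 'b \<Rightarrow> 'b \<Rightarrow> 'b" and x y z
  have right: "contraction br N x (contraction br N y z) = C (\<lambda>x y z. br x (br y z)) x y z" for x y z
    unfolding contraction_def[of br N x] N_contraction
    by (simp add: contraction_def C_def br_lin N_lin NN[of x "br y z"] algebra_simps)
  have left: "contraction br N (contraction br N x y) z = C (\<lambda>x y z. br (br x y) z) x y z" for x y z
    unfolding contraction_def[of br N _ z] N_contraction
    by (simp add: contraction_def C_def br_lin N_lin NN[of "br x y" z] algebra_simps)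
  have leibniz_contraction: "contraction br N x (contraction br N y z) =
      contraction br N (contraction br N x y) z + contraction br N y (contraction br N x z)" for x y z
    unfolding left right C_def
    by (simp add: leibniz[of x] leibniz[of "N x"] N_lin algebra_simps)
  have "bilinear_map sg sg sg (contraction br N)"
    using bilinear_map_coboundary[OF bilinear_br N.linear_axioms N.linear_axioms]
    by (simp add: contraction_def[abs_def])
  with leibniz_contraction show ?thesis
    by (intro leibniz_algebra.intro leibniz_algebra_axioms.intro vector_space_axioms)
qed

text \<open>
  The Nijenhuis identity is quadratic in the operator.  For \<open>I + tN\<close> its parts of order \<open>0\<close> and \<open>1\<close> in \<open>t\<close>
  hold for every linear \<open>N\<close>, and the part of order \<open>2\<close> is the identity for \<open>N\<close>.
\<close>

lemma nijenhuis_operator_pencil: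
  assumes L: "leibniz_algebra sg br" and N: "nijenhuis_operator sg br N"
  shows "nijenhuis_operator sg br (\<lambda>x. x + sg t (N x))"
proof -
  interpret leibniz_algebra sg br by (fact L)
  note br_lin = bilinear_map_simps[OF bilinear_br]
  interpret N: Vector_Spaces.linear sg sg N using N by (simp add: nijenhuis_operator_def)
  note N_lin = N.add N.scale N.diff
  have NN: "br (N x) (N y) = N (br (N x) y) + N (br x (N y)) - N (N (br x y))" for x y
    using N by (simp add: nijenhuis_operator_def N_lin)
  show ?thesis
    by (simp add: nijenhuis_operator_def Vector_Spaces.linear_iff vector_space_axioms br_lin N_lin NN
        scale_right_distrib scale_right_diff_distrib scale_left_commute algebra_simps)
qed

lemma contraction_pencil:
  assumes L: "leibniz_algebra sg br"
  shows "contraction br (\<lambda>x. x + sg t (N x)) = deform sg br (contraction br N) t"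
proof -
  interpret leibniz_algebra sg br by (fact L)
  note br_lin = bilinear_map_simps[OF bilinear_br]
  show ?thesis
    by (simp add: fun_eq_iff contraction_def deform_def br_lin
        scale_right_distrib scale_right_diff_distrib algebra_simps)
qed

section \<open>Semidirect products\<close>

definition semidirect :: "('g \<Rightarrow> 'g \<Rightarrow> 'g) \<Rightarrow> ('g \<Rightarrow> 'v \<Rightarrow> 'v) \<Rightarrow> ('g \<Rightarrow> 'v \<Rightarrow> 'v) \<Rightarrow>
    'g \<times> 'v \<Rightarrow> 'g \<times> 'v \<Rightarrow> 'g \<times> 'v::ab_group_add" where
  "semidirect br rhoL rhoR p q =
    (br (fst p) (fst q), rhoL (fst p) (snd q) + rhoR (fst q) (snd p))"

lemma
  assumes "vector_space sg" "vector_space sv"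
  shows vector_space_scale_prod: "vector_space (module_prod.scale sg sv)"
    and scale_prod: "module_prod.scale sg sv c p = (sg c (fst p), sv c (snd p))"
proof -
  interpret vector_space_prod sg sv by (intro vector_space_prod.intro vector_space_pair.intro assms)
  show "vector_space (module_prod.scale sg sv)" by (fact p.vector_space_axioms)
  show "module_prod.scale sg sv c p = (sg c (fst p), sv c (snd p))" by (fact scale_def)
qed

lemma leibniz_algebra_semidirect:
  assumes R: "leibniz_representation sg br sv rhoL rhoR"
  shows "leibniz_algebra (module_prod.scale sg sv) (semidirect br rhoL rhoR)"
proof -
  interpret leibniz_representation sg br sv rhoL rhoR by (fact R)
  note lin = bilinear_map_simps[OF bilinear_br] bilinear_map_simps[OF bilinear_rhoL]
    bilinear_map_simps[OF bilinear_rhoR]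
  let ?s = "module_prod.scale sg sv" and ?B = "semidirect br rhoL rhoR"
  have "bilinear_map ?s ?s ?s ?B"
    by (simp add: bilinear_map_def Vector_Spaces.linear_iff vector_space_scale_prod vector_space_axioms
        V.vector_space_axioms semidirect_def scale_prod lin V.scale_right_distrib)
  moreover have "?B p (?B q r) = ?B (?B p q) r + ?B q (?B p r)" for p q r
  proof (rule prod_eqI)
    show "fst (?B p (?B q r)) = fst (?B (?B p q) r + ?B q (?B p r))"
      by (simp add: semidirect_def leibniz[of "fst p" "fst q" "fst r"])
    show "snd (?B p (?B q r)) = snd (?B (?B p q) r + ?B q (?B p r))"
      by (simp add: semidirect_def lin rhoL_br rhoR_br commutator_def rhoR_rhoL)
  qed
  ultimately show ?thesis
    by (intro leibniz_algebra.intro leibniz_algebra_axioms.intro vector_space_scale_prod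
        vector_space_axioms V.vector_space_axioms)
qed

text \<open>
  The Leibniz identity on \<open>g \<times> V\<close> is evaluated at triples with at most one entry from \<open>V\<close>: no such
  entry gives the identity of \<open>g\<close>, and an entry \<open>v\<close> in third or second position gives the commutator
  formulas for \<open>\<rho>\<^sup>L([x,y])\<close> and \<open>\<rho>\<^sup>R([x,y])\<close>.  With \<open>v\<close> in first position one gets a second formula for
  \<open>\<rho>\<^sup>R([x,y])\<close>, and comparing the two yields \<open>\<rho>\<^sup>R(y)\<rho>\<^sup>L(x) = -\<rho>\<^sup>R(y)\<rho>\<^sup>R(x)\<close>.
\<close>

lemma leibniz_representation_of_semidirect:
  assumes "leibniz_algebra (module_prod.scale sg sv) (semidirect br rhoL rhoR)"
    and "bilinear_map sg sg sg br" "bilinear_map sg sv sv rhoL" "bilinear_map sg sv sv rhoR"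
  shows "leibniz_representation sg br sv rhoL rhoR"
proof -
  have vs: "vector_space sg" "vector_space sv"
    using assms(3) by (auto simp: bilinear_map_def Vector_Spaces.linear_iff)
  note zero = assms(2-4)[THEN bilinear_map_simps(7)] assms(2-4)[THEN bilinear_map_simps(8)]
  have leib: "semidirect br rhoL rhoR p (semidirect br rhoL rhoR q r) =
      semidirect br rhoL rhoR (semidirect br rhoL rhoR p q) r +
      semidirect br rhoL rhoR q (semidirect br rhoL rhoR p r)" for p q r
    by (rule leibniz_algebra.leibniz[OF assms(1)])
  have br: "br x (br y z) = br (br x y) z + br y (br x z)" for x y z
    using leib[of "(x, 0)" "(y, 0)" "(z, 0)"] by (simp add: semidirect_def)
  have L: "rhoL x (rhoL y v) = rhoL (br x y) v + rhoL y (rhoL x v)" for x y v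
    using leib[of "(x, 0)" "(y, 0)" "(0, v)"] by (simp add: semidirect_def zero)
  have R: "rhoL x (rhoR y v) = rhoR y (rhoL x v) + rhoR (br x y) v" for x y v
    using leib[of "(x, 0)" "(0, v)" "(y, 0)"] by (simp add: semidirect_def zero)
  have R': "rhoR (br x y) v = rhoR y (rhoR x v) + rhoL x (rhoR y v)" for x y v
    using leib[of "(0, v)" "(x, 0)" "(y, 0)"] by (simp add: semidirect_def zero)
  have RL: "rhoR y (rhoL x v) = - rhoR y (rhoR x v)" for x y v
    using R[of x y v] R'[of x y v] by (simp add: eq_neg_iff_add_eq_0 add.assoc [symmetric])
  interpret vector_space sg by (fact vs(1))
  interpret V: vector_space sv by (fact vs(2))
  show ?thesis
  proof
    show "br x (br y z) = br (br x y) z + br y (br x z)" for x y z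
      by (fact br)
    show "rhoL (br x y) = commutator (rhoL x) (rhoL y)" for x y
      using L[of x y] by (simp add: commutator_def fun_eq_iff eq_diff_eq)
    show "rhoR (br x y) = commutator (rhoL x) (rhoR y)" for x y
      using R[of x y] by (simp add: commutator_def fun_eq_iff)
    show "rhoR y (rhoL x v) = - rhoR y (rhoR x v)" for x y v
      by (fact RL)
  qed (fact assms(2-4))+
qed

text \<open>
  Both sides of the identity for \<open>N \<times> S\<close> are bilinear, so it splits into the identities for two
  elements of \<open>g\<close> and for one element of \<open>g\<close> and one of \<open>V\<close> on either side, which are the three
  identities of a Nijenhuis pair; two elements of \<open>V\<close> multiply to \<open>0\<close>.
\<close>

lemma nijenhuis_operator_semidirect:
  assumes R: "leibniz_representation sg br sv rhoL rhoR"
    and P: "nijenhuis_pair sg br sv rhoL rhoR N S"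
  shows "nijenhuis_operator (module_prod.scale sg sv) (semidirect br rhoL rhoR) (map_prod N S)"
proof -
  interpret leibniz_representation sg br sv rhoL rhoR by (fact R)
  interpret S: Vector_Spaces.linear sv sv S using P by (simp add: nijenhuis_pair_def)
  have N: "nijenhuis_operator sg br N" using P by (simp add: nijenhuis_pair_def)
  then interpret N: Vector_Spaces.linear sg sg N by (simp add: nijenhuis_operator_def)
  show ?thesis
    using N P by (simp add: nijenhuis_operator_def Vector_Spaces.linear_iff vector_space_scale_prod
        vector_space_axioms V.vector_space_axioms nijenhuis_pair_def
        semidirect_def scale_prod prod_eq_iff N.add N.scale N.diff S.add S.scale S.diff algebra_simps)
qed

lemma contraction_semidirect:
  assumes "Vector_Spaces.linear sv sv S"
  shows "contraction (semidirect br rhoL rhoR) (map_prod N S) =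
    semidirect (contraction br N)
      (\<lambda>x v. rhoL (N x) v + rhoL x (S v) - S (rhoL x v))
      (\<lambda>x v. rhoR (N x) v + rhoR x (S v) - S (rhoR x v))"
  using assms by (simp add: fun_eq_iff contraction_def semidirect_def Vector_Spaces.linear_iff prod_eq_iff algebra_simps)

lemma deform_semidirect:
  assumes "vector_space sg" "vector_space sv"
  shows "deform (module_prod.scale sg sv) (semidirect br rhoL rhoR) (semidirect omega varpiL varpiR) t =
    semidirect (deform sg br omega t) (deform sv rhoL varpiL t) (deform sv rhoR varpiR t)"
proof -
  interpret V: vector_space sv by (fact assms(2))
  show ?thesis
    using assms by (simp add: fun_eq_iff deform_def semidirect_def scale_prod prod_eq_iff
        V.scale_right_distrib)
qed

section \<open>The trivial deformation generated by a Nijenhuis pair\<close>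

theorem theorem3p4:
  fixes sg :: "'k::field_char_0 \<Rightarrow> 'g::ab_group_add \<Rightarrow> 'g" and Bg :: "'g set"
    and sv :: "'k \<Rightarrow> 'v::ab_group_add \<Rightarrow> 'v" and Bv :: "'v set"
    and br :: "'g \<Rightarrow> 'g \<Rightarrow> 'g" and rhoL rhoR :: "'g \<Rightarrow> 'v \<Rightarrow> 'v"
    and N :: "'g \<Rightarrow> 'g" and S :: "'v \<Rightarrow> 'v"
    and omega :: "'g \<Rightarrow> 'g \<Rightarrow> 'g" and varpiL varpiR :: "'g \<Rightarrow> 'v \<Rightarrow> 'v"
  assumes "finite_dimensional_vector_space sg Bg"
    and "finite_dimensional_vector_space sv Bv"
    and "leibniz_algebra sg br"
    and "leibniz_representation sg br sv rhoL rhoR"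
    and "nijenhuis_pair sg br sv rhoL rhoR N S"
    and "\<And>y1 y2. omega y1 y2 = br (N y1) y2 + br y1 (N y2) - N (br y1 y2)"
    and "\<And>y v. varpiL y v = rhoL (N y) v + rhoL y (S v) - S (rhoL y v)"
    and "\<And>y v. varpiR y v = rhoR (N y) v + rhoR y (S v) - S (rhoR y v)"
  shows "generates_trivial_infinitesimal_deformation sg br sv rhoL rhoR omega varpiL varpiR"
proof -
  interpret leibniz_representation sg br sv rhoL rhoR by (fact assms(4))
  have N: "Vector_Spaces.linear sg sg N" and S: "Vector_Spaces.linear sv sv S"
    using assms(5) by (auto simp: nijenhuis_pair_def nijenhuis_operator_def)
  have omega: "omega = (\<lambda>x y. br (N x) y + br x (N y) - N (br x y))"
    and varpiL: "varpiL = (\<lambda>y v. rhoL (N y) v + rhoL y (S v) - S (rhoL y v))"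
    and varpiR: "varpiR = (\<lambda>y v. rhoR (N y) v + rhoR y (S v) - S (rhoR y v))"
    by (simp_all add: fun_eq_iff assms(6-8))
  have bil: "bilinear_map sg sg sg omega" "bilinear_map sg sv sv varpiL" "bilinear_map sg sv sv varpiR"
    unfolding omega varpiL varpiR
    by (intro bilinear_map_coboundary bilinear_br bilinear_rhoL bilinear_rhoR N S)+
  let ?s = "module_prod.scale sg sv" and ?B = "semidirect br rhoL rhoR"
  define M where "M t p = p + ?s t (map_prod N S p)" for t p
  have M: "M t (x, v) = (x + sg t (N x), v + sv t (S v))" for t x v
    by (simp add: M_def scale_prod vector_space_axioms V.vector_space_axioms)
  note semi = leibniz_algebra_semidirect[OF assms(4)]
  have nij: "nijenhuis_operator ?s ?B (M t)" for t
    unfolding M_def by (rule nijenhuis_operator_pencil[OF semi nijenhuis_operator_semidirect[OF assms(4,5)]])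
  have "contraction ?B (map_prod N S) = semidirect omega varpiL varpiR"
    unfolding contraction_semidirect[OF S] omega varpiL varpiR
    by (simp add: contraction_def[of br, abs_def])
  then have contr: "contraction ?B (M t) =
      semidirect (deform sg br omega t) (deform sv rhoL varpiL t) (deform sv rhoR varpiR t)" for t
    unfolding M_def contraction_pencil[OF semi] by (simp add: deform_semidirect vector_space_axioms V.vector_space_axioms)
  have rep: "leibniz_representation sg (deform sg br omega t) sv
      (deform sv rhoL varpiL t) (deform sv rhoR varpiR t)" for t
    using leibniz_algebra_contraction[OF semi nij[of t]]
    by (intro leibniz_representation_of_semidirect bilinear_map_deform bil bilinear_br bilinear_rhoL
        bilinear_rhoR) (simp add: contr)
  have hom: "M t (semidirect (deform sg br omega t) (deform sv rhoL varpiL t) (deform sv rhoR varpiR t)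
        (x, u) (y, v)) = ?B (M t (x, u)) (M t (y, v))" for t x u y v
    unfolding contr[symmetric] by (rule nijenhuis_operator_contraction[OF nij])
  interpret N: Vector_Spaces.linear sg sg N by (fact N)
  interpret S: Vector_Spaces.linear sv sv S by (fact S)
  note zero = N.zero S.zero bilinear_map_simps(7,8)[OF bilinear_rhoL] bilinear_map_simps(7,8)[OF bilinear_rhoR]
    bilinear_map_simps(7,8)[OF bilinear_map_deform[OF bilinear_rhoL bil(2)]]
    bilinear_map_simps(7,8)[OF bilinear_map_deform[OF bilinear_rhoR bil(3)]]
  \<comment> \<open>Each of the three equivalences is one component of \<open>hom\<close> at elements of \<open>g\<close> and \<open>V\<close>.\<close>
  have "equivalent_to_undeformed sg br sv rhoL rhoR omega varpiL varpiR"
    unfolding equivalent_to_undeformed_def Let_def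
  proof (rule exI[of _ N], rule exI[of _ S], intro conjI allI N S)
    fix t x y v
    show "deform sg br omega t x y + sg t (N (deform sg br omega t x y)) = br (x + sg t (N x)) (y + sg t (N y))"
      using hom[of t x 0 y 0] by (simp add: semidirect_def M)
    show "deform sv rhoL varpiL t x v + sv t (S (deform sv rhoL varpiL t x v)) =
        rhoL (x + sg t (N x)) (v + sv t (S v))"
      using hom[of t x 0 0 v] by (simp add: semidirect_def M zero)
    show "deform sv rhoR varpiR t x v + sv t (S (deform sv rhoR varpiR t x v)) =
        rhoR (x + sg t (N x)) (v + sv t (S v))"
      using hom[of t 0 v x 0] by (simp add: semidirect_def M zero)
  qed
  then show ?thesis
    using bil rep by (auto simp: generates_trivial_infinitesimal_deformation_def
        generates_infinitesimal_deformation_def leibniz_representation_def)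
qed

end
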